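(* Let $\mathcal{M}$ be a separable metric space, $f:\mathcal{M}\to\mathcal{M}$ continuous, and $\mathcal{X}\subseteq\mathcal{M}$ forward invariant under $f$. For any $\xi\in\mathcal{X}$, if the trajectory through $\xi$ is forward precompact in $\mathcal{X}$, then $\omega_{\mathcal{X}}(\xi)$ is nonempty. Moreover, if $\mathcal{M}=\mathbb{R}^n$, $f(x)=Ax$ on $\mathcal{X}$ for some $A\in\mathbb{R}^{n\times n}$, and $\mathcal{X}$ is closed in $\mathbb{R}^n$, then conversely, $\omega_{\mathcal{X}}(\xi)\neq\emptyset$ implies that the trajectory through $\xi$ is forward precompact in $\mathcal{X}$.
   Context: The forward orbit of $\xi$ is $\{f^k(\xi)\mid k\in\mathbb{N}\}$; the trajectory through $\xi$ is forward precompact in $\mathcal{X}$ if the closure of its forward orbit in $\mathcal{X}$ is compact. $\omega_{\mathcal{X}}(\xi)$ is the set of $x\in\mathcal{X}$ such that $f^{k_j}(\xi)\to x$ for some sequence of indices $k_j\to\infty$. *)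

theory Defs
  imports "HOL-Analysis.Analysis"
begin

definition forward_orbit :: "('a \<Rightarrow> 'a) \<Rightarrow> 'a \<Rightarrow> 'a set" where
  "forward_orbit f \<xi> = {(f ^^ k) \<xi> | k. True}"

text \<open>The trajectory through xi is forward precompact in X: the closure of the
  forward orbit in (the subspace) X is compact. The closure relative to X is
  X intersected with the closure in the ambient space.\<close>
definition forward_precompact_in :: "'a::topological_space set \<Rightarrow> ('a \<Rightarrow> 'a) \<Rightarrow> 'a \<Rightarrow> bool" where
  "forward_precompact_in X f \<xi> \<longleftrightarrow> compact (X \<inter> closure (forward_orbit f \<xi>))"

definition omega_limit_in :: "'a::topological_space set \<Rightarrow> ('a \<Rightarrow> 'a) \<Rightarrow> 'a \<Rightarrow> 'a set" where
  "omega_limit_in X f \<xi> = {x \<in> X. \<exists>r::nat \<Rightarrow> nat. strict_mono r \<and> (\<lambda>j. (f ^^ r j) \<xi>) \<longlonglongrightarrow> x}"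

end

theory Submission
  imports Defs "HOL-Computational_Algebra.Fundamental_Theorem_Algebra"
begin

text \<open>
  The first part is sequential compactness of the closure of the orbit. For the converse it
  suffices that the orbit of a linear map is bounded as soon as it is bounded at infinitely many
  times \<open>S\<close>, since then the orbit closure inside the closed set \<open>X\<close> is compact. Work over
  \<open>\<complex>\<close>, take a nonzero polynomial \<open>p\<close> with \<open>p(A) \<xi> = 0\<close> and induct on its degree: for a root
  \<open>l\<close> of \<open>p = (x - l) q\<close>, the vector \<open>u = (A - l) \<xi>\<close> is annihilated by \<open>q\<close> and bounded on \<open>S\<close>,
  so by induction its orbit is bounded, and \<open>A\<^sup>k\<^sup>+\<^sup>1 \<xi> = l A\<^sup>k \<xi> + A\<^sup>k u\<close>. This recursion is contracting
  for \<open>|l| < 1\<close> and can be run backwards from the times in \<open>S\<close> for \<open>|l| > 1\<close>. For \<open>|l| = 1\<close>,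
  if \<open>q(l) \<noteq> 0\<close> then \<open>\<xi>\<close> is an eigenvector plus a vector of bounded orbit; otherwise \<open>\<xi>\<close> is
  already annihilated by \<open>q\<close>, because a Jordan chain of length two would grow linearly.
\<close>

text \<open>\<^term>\<open>poly_act C p x\<close> is \<open>p(C) x\<close>, computed by Horner's scheme.\<close>

definition poly_act :: "'a::field^'n^'n \<Rightarrow> 'a poly \<Rightarrow> 'a^'n \<Rightarrow> 'a^'n" where
  "poly_act C p = fold_coeffs (\<lambda>a f x. a *s x + C *v f x) p (\<lambda>x. 0)"

lemma poly_act_0 [simp]: "poly_act C 0 x = 0"
  by (simp add: poly_act_def)

lemma poly_act_pCons [simp]: "poly_act C (pCons a p) x = a *s x + C *v poly_act C p x"
  by (cases "p = 0 \<and> a = 0") (auto simp: poly_act_def)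

lemma poly_act_add_vec: "poly_act C p (x + y) = poly_act C p x + poly_act C p y"
  by (induction p) (simp_all add: vec.add vector_add_ldistrib)

lemma poly_act_scale_vec: "poly_act C p (c *s x) = c *s poly_act C p x"
  by (induction p) (simp_all add: vec.scale vec.add)

lemma linear_poly_act: "Vector_Spaces.linear (*s) (*s) (poly_act C p)"
  by (simp add: Vector_Spaces.linear_iff vec.vector_space_axioms poly_act_add_vec poly_act_scale_vec)

lemma poly_act_add: "poly_act C (p + q) x = poly_act C p x + poly_act C q x"
  by (induction p q rule: poly_induct2) (simp_all add: vec.add vector_sadd_rdistrib)

lemma poly_act_smult: "poly_act C (smult a p) x = a *s poly_act C p x"
  by (induction p) (simp_all add: vec.scale vector_add_ldistrib vector_smult_assoc)

lemma poly_act_mult: "poly_act C (p * q) x = poly_act C p (poly_act C q x)"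
  by (induction p) (simp_all add: poly_act_add poly_act_smult)

lemma poly_act_monom: "poly_act C (monom a k) x = a *s ((*v) C ^^ k) x"
  by (induction k) (simp_all add: monom_0 monom_Suc vec.scale)

lemma poly_act_linear_factor: "poly_act C [:-l, 1:] x = C *v x - l *s x"
  by (simp add: vector_smult_lneg)

lemma poly_act_commute: "poly_act C p (C *v x) = C *v poly_act C p x"
  by (induction p) (simp_all add: vec.add vec.scale)

lemma poly_act_funpow_commute: "poly_act C p (((*v) C ^^ k) x) = ((*v) C ^^ k) (poly_act C p x)"
  by (induction k) (simp_all add: poly_act_commute)

lemma poly_act_sum: "poly_act C (\<Sum>i\<in>I. p i) x = (\<Sum>i\<in>I. poly_act C (p i) x)"
  by (induction I rule: infinite_finite_induct) (simp_all add: poly_act_add)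

lemma nontrivial_linear_relation:
  fixes f :: "nat \<Rightarrow> 'a::field^'n"
  obtains c where "\<exists>i\<le>CARD('n). c i \<noteq> 0" "(\<Sum>i\<le>CARD('n). c i *s f i) = 0"
proof (cases "inj_on f {..CARD('n)}")
  case True
  have "vec.dim (f ` {..CARD('n)}) \<le> CARD('n)"
    using vec.dim_subset_UNIV by (simp add: vec.dimension_def card_cart_basis)
  then have "vec.dependent (f ` {..CARD('n)})"
    using True by (intro vec.dependent_biggerset_general) (simp add: card_image)
  then obtain u where u: "\<exists>v\<in>f ` {..CARD('n)}. u v \<noteq> 0" "(\<Sum>v\<in>f ` {..CARD('n)}. u v *s v) = 0"
    using vec.dependent_finite[of "f ` {..CARD('n)}"] by blast
  have "\<exists>i\<le>CARD('n). u (f i) \<noteq> 0"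
    using u(1) by blast
  moreover have "(\<Sum>i\<le>CARD('n). u (f i) *s f i) = 0"
    using u(2) by (simp only: sum.reindex[OF True] o_def)
  ultimately show ?thesis
    by (rule that)
next
  case False
  then obtain i j where "i \<le> CARD('n)" "j \<le> CARD('n)" "i \<noteq> j" "f i = f j"
    by (auto simp: inj_on_def)
  define c where "c k = (if k = i then 1 else 0) - (if k = j then (1::'a) else 0)" for k
  have "c k *s f k = (if k = i then f i else 0) - (if k = j then f j else 0)" for k
    by (simp add: c_def vector_sub_rdistrib)
  then have "(\<Sum>k\<le>CARD('n). c k *s f k) = 0"
    using \<open>i \<le> CARD('n)\<close> \<open>j \<le> CARD('n)\<close> \<open>f i = f j\<close> by (simp add: sum_subtractf)
  moreover have "c i \<noteq> 0" using \<open>i \<noteq> j\<close> by (simp add: c_def)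
  ultimately show ?thesis
    using \<open>i \<le> CARD('n)\<close> by (intro that[of c]) auto
qed

lemma exists_annihilating_poly:
  fixes C :: "'a::field^'n^'n"
  shows "\<exists>p. p \<noteq> 0 \<and> poly_act C p v = 0"
proof -
  obtain c where c: "\<exists>i\<le>CARD('n). c i \<noteq> 0" "(\<Sum>i\<le>CARD('n). c i *s ((*v) C ^^ i) v) = 0"
    by (rule nontrivial_linear_relation[of "\<lambda>i. ((*v) C ^^ i) v"])
  define p where "p = (\<Sum>i\<le>CARD('n). monom (c i) i)"
  have "coeff p i = c i" if "i \<le> CARD('n)" for i
    using that by (simp add: p_def coeff_sum coeff_monom)
  then have "p \<noteq> 0" using c(1) by auto
  moreover have "poly_act C p v = 0"
    using c(2) by (simp add: p_def poly_act_sum poly_act_monom)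
  ultimately show ?thesis by blast
qed

lemma funpow_matrix_vector_add:
  fixes C :: "'a::field^'n^'n"
  shows "((*v) C ^^ k) (x + y) = ((*v) C ^^ k) x + ((*v) C ^^ k) y"
  by (induction k) (simp_all add: vec.add)

lemma funpow_eigenvector:
  fixes C :: "'a::field^'n^'n"
  shows "C *v w = l *s w \<Longrightarrow> ((*v) C ^^ k) w = l ^ k *s w"
  by (induction k) (simp_all add: vec.scale vector_smult_assoc mult.commute)

text \<open>Both sides are multiplied by \<open>l\<close> so that no index \<open>k - 1\<close> occurs.\<close>

lemma funpow_jordan_chain:
  fixes C :: "'a::field^'n^'n"
  assumes w: "C *v w = l *s w" and z: "C *v z = l *s z + w"
  shows "l *s ((*v) C ^^ k) z = l ^ Suc k *s z + (of_nat k * l ^ k) *s w"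
proof (induction k)
  case 0
  show ?case by simp
next
  case (Suc k)
  have "l *s ((*v) C ^^ Suc k) z = C *v (l *s ((*v) C ^^ k) z)"
    by (simp add: vec.scale)
  also have "\<dots> = l ^ Suc k *s (l *s z + w) + (of_nat k * l ^ k) *s (l *s w)"
    by (simp add: Suc vec.add vec.scale w z)
  also have "\<dots> = l ^ Suc (Suc k) *s z + (of_nat (Suc k) * l ^ Suc k) *s w"
    by (simp add: vector_add_ldistrib vector_smult_assoc vector_sadd_rdistrib algebra_simps)
  finally show ?case .
qed

lemma funpow_recurrence:
  fixes C :: "'a::field^'n^'n"
  shows "((*v) C ^^ Suc k) v = l *s ((*v) C ^^ k) v + ((*v) C ^^ k) (poly_act C [:-l, 1:] v)"
proof -
  have "((*v) C ^^ k) (poly_act C [:-l, 1:] v) = C *v ((*v) C ^^ k) v - l *s ((*v) C ^^ k) v"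
    unfolding poly_act_funpow_commute[symmetric] by (rule poly_act_linear_factor)
  then show ?thesis by simp
qed

lemma norm_vector_scalar_mult: "norm (c *s x) = norm c * norm (x :: 'a::real_normed_div_algebra^'n)"
  unfolding norm_vec_def by (simp add: norm_mult L2_set_right_distrib)

lemma bounded_linear_poly_act:
  fixes C :: "complex^'n^'n"
  shows "bounded_linear (poly_act C p)"
proof -
  have "poly_act C p = (*v) (matrix (poly_act C p))"
    by (simp add: fun_eq_iff matrix_works[OF linear_poly_act])
  then show ?thesis
    by (metis matrix_vector_mul_bounded_linear)
qed

lemma bounded_orbit_poly_act:
  fixes C :: "complex^'n^'n"
  assumes "bounded ((\<lambda>k. ((*v) C ^^ k) v) ` S)"
  shows "bounded ((\<lambda>k. ((*v) C ^^ k) (poly_act C p v)) ` S)"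
proof -
  have "(\<lambda>k. ((*v) C ^^ k) (poly_act C p v)) ` S = poly_act C p ` (\<lambda>k. ((*v) C ^^ k) v) ` S"
    by (simp add: image_image poly_act_funpow_commute)
  then show ?thesis
    using bounded_linear_image[OF assms bounded_linear_poly_act] by simp
qed

lemma bounded_range_contracting_recurrence:
  fixes a b :: "nat \<Rightarrow> 'a::real_normed_div_algebra^'n"
  assumes rec: "\<And>k. a (Suc k) = l *s a k + b k" and l: "norm l < 1" and "bounded (range b)"
  shows "bounded (range a)"
proof -
  obtain M where M: "\<And>k. norm (b k) \<le> M"
    using \<open>bounded (range b)\<close> by (auto simp: bounded_iff)
  define D where "D = max (norm (a 0)) (M / (1 - norm l))"
  have "M / (1 - norm l) \<le> D" by (simp add: D_def)
  then have MD: "M \<le> (1 - norm l) * D" using l by (simp add: field_simps)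
  have "norm (a k) \<le> D" for k
  proof (induction k)
    case 0
    show ?case by (simp add: D_def)
  next
    case (Suc k)
    have "norm (a (Suc k)) \<le> norm l * norm (a k) + M"
      using norm_triangle_ineq[of "l *s a k" "b k"] M[of k] by (simp add: rec norm_vector_scalar_mult)
    also have "\<dots> \<le> norm l * D + M"
      using Suc by (simp add: mult_left_mono)
    also have "\<dots> \<le> D"
      using MD by (simp add: algebra_simps)
    finally show ?case .
  qed
  then show ?thesis by (auto simp: bounded_iff)
qed

lemma bounded_range_expanding_recurrence:
  fixes a b :: "nat \<Rightarrow> 'a::real_normed_div_algebra^'n"
  assumes rec: "\<And>k. a (Suc k) = l *s a k + b k" and l: "norm l > 1" and "bounded (range b)"
    and "infinite S" and "bounded (a ` S)"
  shows "bounded (range a)"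
proof -
  obtain M where M: "\<And>k. norm (b k) \<le> M"
    using \<open>bounded (range b)\<close> by (auto simp: bounded_iff)
  obtain B where B: "\<And>n. n \<in> S \<Longrightarrow> norm (a n) \<le> B"
    using \<open>bounded (a ` S)\<close> by (auto simp: bounded_iff)
  define D where "D = max B (M / (norm l - 1))"
  have "M / (norm l - 1) \<le> D" by (simp add: D_def)
  then have MD: "M \<le> (norm l - 1) * D" using l by (simp add: field_simps)
  have backwards: "norm (a k) \<le> D" if "norm (a (Suc k)) \<le> D" for k
  proof -
    have "norm l * norm (a k) = norm (a (Suc k) - b k)"
      by (simp add: rec norm_vector_scalar_mult)
    also have "\<dots> \<le> D + M"
      using that M[of k] norm_triangle_ineq4[of "a (Suc k)" "b k"] by simp
    also have "\<dots> \<le> norm l * D"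
      using MD by (simp add: algebra_simps)
    finally have "norm l * norm (a k) \<le> norm l * D" .
    moreover have "norm l > 0" using l by linarith
    ultimately show ?thesis by simp
  qed
  have "norm (a k) \<le> D" for k
  proof -
    obtain n where "n \<in> S" "k \<le> n"
      using \<open>infinite S\<close> by (meson infinite_nat_iff_unbounded_le)
    then have "norm (a n) \<le> D" using B[OF \<open>n \<in> S\<close>] by (simp add: D_def le_max_iff_disj)
    with \<open>k \<le> n\<close> show ?thesis
      by (induction rule: inc_induct) (auto intro: backwards)
  qed
  then show ?thesis by (auto simp: bounded_iff)
qed

lemma bounded_orbit_if_not_unimodular:
  fixes C :: "complex^'n^'n"
  assumes "norm l \<noteq> 1" and "bounded (range (\<lambda>k. ((*v) C ^^ k) (poly_act C [:-l, 1:] v)))"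
    and "infinite S" and "bounded ((\<lambda>k. ((*v) C ^^ k) v) ` S)"
  shows "bounded (range (\<lambda>k. ((*v) C ^^ k) v))"
proof (cases "norm l < 1")
  case True
  from funpow_recurrence True assms(2) show ?thesis
    by (rule bounded_range_contracting_recurrence[where a = "\<lambda>k. ((*v) C ^^ k) v"])
next
  case False
  with assms(1) have "norm l > 1" by linarith
  from funpow_recurrence this assms(2-4) show ?thesis
    by (rule bounded_range_expanding_recurrence[where a = "\<lambda>k. ((*v) C ^^ k) v"])
qed

lemma jordan_chain_orbit_unbounded:
  fixes C :: "'a::real_normed_field^'n^'n"
  assumes w: "C *v w = l *s w" and z: "C *v z = l *s z + w"
    and "norm l = 1" "w \<noteq> 0" "infinite S"
  shows "\<not> bounded ((\<lambda>k. ((*v) C ^^ k) z) ` S)"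
proof
  assume "bounded ((\<lambda>k. ((*v) C ^^ k) z) ` S)"
  then obtain B where B: "\<And>k. k \<in> S \<Longrightarrow> norm (((*v) C ^^ k) z) \<le> B"
    by (auto simp: bounded_iff)
  have growth: "of_nat k * norm w \<le> norm (((*v) C ^^ k) z) + norm z" for k
  proof -
    have "of_nat k * norm w = norm (l *s ((*v) C ^^ k) z - l ^ Suc k *s z)"
      by (simp add: funpow_jordan_chain[OF w z] norm_vector_scalar_mult norm_mult norm_power \<open>norm l = 1\<close>)
    also have "\<dots> \<le> norm (((*v) C ^^ k) z) + norm z"
      using norm_triangle_ineq4[of "l *s ((*v) C ^^ k) z" "l ^ Suc k *s z"]
      by (simp add: norm_vector_scalar_mult norm_mult norm_power \<open>norm l = 1\<close>)
    finally show ?thesis .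
  qed
  obtain j :: nat where j: "(B + norm z) / norm w < of_nat j"
    using reals_Archimedean2 by blast
  obtain k where "k \<in> S" "j \<le> k"
    using \<open>infinite S\<close> by (meson infinite_nat_iff_unbounded_le)
  with j have "(B + norm z) / norm w < of_nat k"
    by (meson of_nat_le_iff order_less_le_trans)
  then have "B + norm z < of_nat k * norm w"
    using \<open>w \<noteq> 0\<close> by (simp add: pos_divide_less_eq)
  with growth[of k] B[OF \<open>k \<in> S\<close>] show False by linarith
qed

lemma poly_act_cancel_repeated_unimodular_root:
  fixes C :: "complex^'n^'n"
  assumes "norm l = 1" and "poly_act C ([:-l, 1:] * ([:-l, 1:] * s)) v = 0"
    and "infinite S" and "bounded ((\<lambda>k. ((*v) C ^^ k) v) ` S)"
  shows "poly_act C ([:-l, 1:] * s) v = 0"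
proof (rule ccontr)
  define z where "z = poly_act C s v"
  define w where "w = poly_act C [:-l, 1:] z"
  assume "poly_act C ([:-l, 1:] * s) v \<noteq> 0"
  then have "w \<noteq> 0" by (simp only: w_def z_def poly_act_mult not_False_eq_True)
  have "poly_act C [:-l, 1:] w = 0"
    using assms(2) by (simp only: w_def z_def poly_act_mult)
  then have "C *v w = l *s w" by (simp add: poly_act_linear_factor)
  moreover have "C *v z = l *s z + w" by (simp add: w_def poly_act_linear_factor)
  moreover have "bounded ((\<lambda>k. ((*v) C ^^ k) z) ` S)"
    unfolding z_def using assms(4) by (rule bounded_orbit_poly_act)
  ultimately show False
    using jordan_chain_orbit_unbounded \<open>norm l = 1\<close> \<open>w \<noteq> 0\<close> \<open>infinite S\<close> by blast
qed

lemma bounded_orbit_if_unimodular_nonroot: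
  fixes C :: "complex^'n^'n" and l :: complex and v :: "complex^'n"
  defines "u \<equiv> poly_act C [:-l, 1:] v"
  assumes "norm l = 1" and "poly q l \<noteq> 0" and "poly_act C q u = 0"
    and "bounded (range (\<lambda>k. ((*v) C ^^ k) u))"
  shows "bounded (range (\<lambda>k. ((*v) C ^^ k) v))"
proof -
  define c where "c = poly q l"
  have "poly (q - [:c:]) l = 0" by (simp add: c_def)
  then obtain s where qs: "q = [:-l, 1:] * s + [:c:]"
    by (metis poly_eq_0_iff_dvd dvdE diff_add_cancel)
  have s_u: "poly_act C ([:-l, 1:] * s) u = - (c *s u)"
    using \<open>poly_act C q u = 0\<close> by (simp add: qs poly_act_add add_eq_0_iff)
  \<comment> \<open>hence \<open>y = -s(C) u / c\<close> solves \<open>(C - l) y = u\<close>, and \<open>v - y\<close> is an eigenvector\<close>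
  define y where "y = poly_act C (smult (- 1 / c) s) u"
  have "poly_act C [:-l, 1:] y = (- 1 / c) *s poly_act C ([:-l, 1:] * s) u"
    by (simp only: y_def poly_act_smult poly_act_scale_vec poly_act_mult)
  also have "\<dots> = u"
    using s_u \<open>poly q l \<noteq> 0\<close>
    by (simp add: c_def vector_smult_assoc vector_smult_rneg)
  finally have "poly_act C [:-l, 1:] y = u" .
  define w where "w = v - y"
  have "C *v w = l *s w"
    using \<open>poly_act C [:-l, 1:] y = u\<close>
    by (simp add: w_def u_def poly_act_linear_factor vec.diff vector_ssub_ldistrib algebra_simps)
  moreover have "v = y + w" by (simp add: w_def)
  ultimately have orbit: "((*v) C ^^ k) v = ((*v) C ^^ k) y + l ^ k *s w" for k
    by (simp only: funpow_matrix_vector_add funpow_eigenvector)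
  have "bounded (range (\<lambda>k. ((*v) C ^^ k) y + l ^ k *s w))"
  proof (rule bounded_plus_comp)
    show "bounded (range (\<lambda>k. ((*v) C ^^ k) y))"
      unfolding y_def using assms(5) by (rule bounded_orbit_poly_act)
    show "bounded (range (\<lambda>k. l ^ k *s w))"
      using \<open>norm l = 1\<close> by (auto simp: bounded_iff norm_vector_scalar_mult norm_power)
  qed
  then show ?thesis by (simp only: orbit)
qed

lemma complex_poly_linear_factor:
  fixes p :: "complex poly"
  assumes "degree p \<noteq> 0"
  obtains l q where "p = [:-l, 1:] * q" and "q \<noteq> 0" and "degree q < degree p"
proof -
  obtain l where "poly p l = 0"
    using fundamental_theorem_of_algebra[of p] assms by (auto simp: constant_degree)
  then obtain q where pq: "p = [:-l, 1:] * q"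
    by (metis poly_eq_0_iff_dvd dvdE)
  with assms have "q \<noteq> 0" by auto
  with pq have "degree q < degree p"
    by (simp add: degree_mult_eq del: mult_pCons_left)
  with pq \<open>q \<noteq> 0\<close> show ?thesis by (rule that)
qed

lemma bounded_orbit_if_annihilated:
  fixes C :: "complex^'n^'n"
  assumes "p \<noteq> 0" and "poly_act C p v = 0"
    and "infinite S" and "bounded ((\<lambda>k. ((*v) C ^^ k) v) ` S)"
  shows "bounded (range (\<lambda>k. ((*v) C ^^ k) v))"
  using assms(1,2,4)
proof (induction "degree p" arbitrary: p v rule: less_induct)
  case less
  show ?case
  proof (cases "degree p = 0")
    case True
    then obtain c where "p = [:c:]" by (rule degree_eq_zeroE)
    with less.prems have "v = 0" by simp
    moreover have "((*v) C ^^ k) 0 = 0" for k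
      by (induction k) simp_all
    ultimately show ?thesis by simp
  next
    case False
    then obtain l q where pq: "p = [:-l, 1:] * q" and "q \<noteq> 0" and "degree q < degree p"
      by (rule complex_poly_linear_factor)
    note IH = less.hyps[OF \<open>degree q < degree p\<close> \<open>q \<noteq> 0\<close>]
    define u where "u = poly_act C [:-l, 1:] v"
    have "poly_act C q u = 0"
      using less.prems(2) by (simp only: u_def pq mult.commute[of "[:-l, 1:]"] poly_act_mult)
    moreover have "bounded ((\<lambda>k. ((*v) C ^^ k) u) ` S)"
      unfolding u_def using less.prems(3) by (rule bounded_orbit_poly_act)
    ultimately have bounded_u: "bounded (range (\<lambda>k. ((*v) C ^^ k) u))"
      by (rule IH)
    consider "norm l \<noteq> 1" | "norm l = 1" "poly q l = 0" | "norm l = 1" "poly q l \<noteq> 0"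
      by blast
    then show ?thesis
    proof cases
      case 1
      with bounded_u \<open>infinite S\<close> less.prems(3) show ?thesis
        unfolding u_def by (intro bounded_orbit_if_not_unimodular)
    next
      case 2
      then obtain s where qs: "q = [:-l, 1:] * s"
        by (metis poly_eq_0_iff_dvd dvdE)
      have "poly_act C q v = 0"
        unfolding qs using 2(1) less.prems(2)[unfolded pq qs] \<open>infinite S\<close> less.prems(3)
        by (rule poly_act_cancel_repeated_unimodular_root)
      then show ?thesis
        using IH less.prems(3) by blast
    next
      case 3
      with \<open>poly_act C q u = 0\<close> bounded_u show ?thesis
        unfolding u_def by (intro bounded_orbit_if_unimodular_nonroot)
    qed
  qed
qed

theorem bounded_orbit_if_bounded_on_infinite_set:
  fixes C :: "complex^'n^'n"
  assumes "infinite S" and "bounded ((\<lambda>k. ((*v) C ^^ k) v) ` S)"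
  shows "bounded (range (\<lambda>k. ((*v) C ^^ k) v))"
  using exists_annihilating_poly bounded_orbit_if_annihilated assms by blast

definition complex_vec :: "real^'n \<Rightarrow> complex^'n" where
  "complex_vec x = (\<chi> i. of_real (x $ i))"

definition complex_mat :: "real^'n^'m \<Rightarrow> complex^'n^'m" where
  "complex_mat A = (\<chi> i j. of_real (A $ i $ j))"

lemma complex_mat_mult_vec: "complex_mat A *v complex_vec x = complex_vec (A *v x)"
  by (simp add: complex_mat_def complex_vec_def vec_eq_iff matrix_vector_mult_def)

lemma funpow_complex_mat:
  fixes A :: "real^'n^'n"
  shows "((*v) (complex_mat A) ^^ k) (complex_vec x) = complex_vec (((*v) A ^^ k) x)"
  by (induction k) (simp_all add: complex_mat_mult_vec)

lemma norm_complex_vec: "norm (complex_vec x) = norm x"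
  by (simp add: complex_vec_def norm_vec_def)

theorem bounded_real_orbit_if_bounded_on_infinite_set:
  fixes A :: "real^'n^'n"
  assumes "infinite S" and "bounded ((\<lambda>k. ((*v) A ^^ k) x) ` S)"
  shows "bounded (range (\<lambda>k. ((*v) A ^^ k) x))"
proof -
  have "bounded ((\<lambda>k. ((*v) (complex_mat A) ^^ k) (complex_vec x)) ` S)"
    using assms(2) by (simp add: bounded_iff funpow_complex_mat norm_complex_vec)
  with assms(1) have "bounded (range (\<lambda>k. ((*v) (complex_mat A) ^^ k) (complex_vec x)))"
    by (rule bounded_orbit_if_bounded_on_infinite_set)
  then show ?thesis
    by (simp add: bounded_iff funpow_complex_mat norm_complex_vec)
qed

lemma funpow_in_invariant: "f ` X \<subseteq> X \<Longrightarrow> \<xi> \<in> X \<Longrightarrow> (f ^^ k) \<xi> \<in> X"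
  by (induction k) auto

lemma funpow_eq_on_invariant:
  assumes "f ` X \<subseteq> X" and "\<xi> \<in> X" and "\<forall>x\<in>X. f x = g x"
  shows "(f ^^ k) \<xi> = (g ^^ k) \<xi>"
proof (induction k)
  case (Suc k)
  then show ?case using assms(3) funpow_in_invariant[OF assms(1,2), of k] by simp
qed simp

lemma omega_limit_in_nonempty_if_forward_precompact:
  fixes f :: "'a::first_countable_topology \<Rightarrow> 'a"
  assumes "f ` X \<subseteq> X" and "\<xi> \<in> X" and "forward_precompact_in X f \<xi>"
  shows "omega_limit_in X f \<xi> \<noteq> {}"
proof -
  let ?K = "X \<inter> closure (forward_orbit f \<xi>)"
  have "(f ^^ k) \<xi> \<in> ?K" for k
    using funpow_in_invariant[OF assms(1,2)] closure_subset[of "forward_orbit f \<xi>"]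
    by (auto simp: forward_orbit_def)
  moreover have "seq_compact ?K"
    using assms(3) by (simp add: forward_precompact_in_def compact_imp_seq_compact)
  ultimately obtain x r where "x \<in> ?K" "strict_mono r" "((\<lambda>k. (f ^^ k) \<xi>) \<circ> r) \<longlonglongrightarrow> x"
    unfolding seq_compact_def by meson
  then have "x \<in> omega_limit_in X f \<xi>"
    by (auto simp: omega_limit_in_def o_def)
  then show ?thesis by blast
qed

lemma forward_precompact_in_if_bounded:
  fixes f :: "'a::heine_borel \<Rightarrow> 'a"
  assumes "closed X" and "bounded (forward_orbit f \<xi>)"
  shows "forward_precompact_in X f \<xi>"
  unfolding forward_precompact_in_def compact_eq_bounded_closed
  using assms by (simp add: bounded_Int bounded_closure closed_Int)

lemma forward_precompact_in_if_linear:
  fixes f :: "real^'n \<Rightarrow> real^'n"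
  assumes "f ` X \<subseteq> X" and "\<xi> \<in> X" and "\<forall>x\<in>X. f x = A *v x" and "closed X"
    and "omega_limit_in X f \<xi> \<noteq> {}"
  shows "forward_precompact_in X f \<xi>"
proof -
  have orbit: "(f ^^ k) \<xi> = ((*v) A ^^ k) \<xi>" for k
    using assms(1-3) by (rule funpow_eq_on_invariant)
  obtain x r where r: "strict_mono r" and lim: "(\<lambda>j. (f ^^ r j) \<xi>) \<longlonglongrightarrow> x"
    using assms(5) unfolding omega_limit_in_def by blast
  have "bounded (range (\<lambda>j. (f ^^ r j) \<xi>))"
    using convergent_imp_Bseq[OF convergentI[OF lim]] by (simp add: Bseq_eq_bounded)
  then have "bounded ((\<lambda>k. ((*v) A ^^ k) \<xi>) ` range r)"
    by (simp add: orbit image_image)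
  moreover have "infinite (range r)"
    using r by (simp add: range_inj_infinite strict_mono_imp_inj_on)
  ultimately have "bounded (range (\<lambda>k. ((*v) A ^^ k) \<xi>))"
    by (intro bounded_real_orbit_if_bounded_on_infinite_set)
  moreover have "forward_orbit f \<xi> = range (\<lambda>k. ((*v) A ^^ k) \<xi>)"
    by (auto simp: forward_orbit_def orbit)
  ultimately show ?thesis
    using forward_precompact_in_if_bounded[OF \<open>closed X\<close>] by simp
qed

theorem lemma7:
  shows "(\<forall>(f :: 'a::metric_space \<Rightarrow> 'a) X \<xi>.
           separable_space (euclidean :: 'a topology) \<and> continuous_on UNIV f \<and> f ` X \<subseteq> X \<and> \<xi> \<in> X
           \<and> forward_precompact_in X f \<xi> \<longrightarrow> omega_limit_in X f \<xi> \<noteq> {})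
    \<and> (\<forall>(f :: real^'n \<Rightarrow> real^'n) (A :: real^'n^'n) X \<xi>.
           continuous_on UNIV f \<and> f ` X \<subseteq> X \<and> \<xi> \<in> X \<and> (\<forall>x\<in>X. f x = A *v x) \<and> closed X
           \<and> omega_limit_in X f \<xi> \<noteq> {} \<longrightarrow> forward_precompact_in X f \<xi>)"
proof (intro conjI allI impI)
  fix f :: "'a \<Rightarrow> 'a" and X \<xi>
  assume "separable_space (euclidean :: 'a topology) \<and> continuous_on UNIV f \<and> f ` X \<subseteq> X \<and> \<xi> \<in> X
    \<and> forward_precompact_in X f \<xi>"
  then show "omega_limit_in X f \<xi> \<noteq> {}"
    using omega_limit_in_nonempty_if_forward_precompact by blast
next
  fix f :: "real^'n \<Rightarrow> real^'n" and A :: "real^'n^'n" and X \<xi>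
  assume "continuous_on UNIV f \<and> f ` X \<subseteq> X \<and> \<xi> \<in> X \<and> (\<forall>x\<in>X. f x = A *v x) \<and> closed X
    \<and> omega_limit_in X f \<xi> \<noteq> {}"
  then show "forward_precompact_in X f \<xi>"
    using forward_precompact_in_if_linear by blast
qed

end
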